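(* Let $H_1,H_2$ be vertex- and edge-disjoint hypergraphs. Then: (i) $T_{\mathrm{HG}}(H_1\cup H_2)=T_{\mathrm{HG}}(H_1)\,T_{\mathrm{HG}}(H_2)$, where $H_1\cup H_2$ is the disjoint union. (ii) Let $H_1*H_2$ be the vertex join of $H_1$ and $H_2$ obtained by identifying a vertex $v_1\in V(H_1)$ with a vertex $v_2\in V(H_2)$ into a single vertex $v$ (leaving all edges otherwise unchanged). Then $T_{\mathrm{HG}}(H_1*H_2)=T_{\mathrm{HG}}(H_1)\,T_{\mathrm{HG}}(H_2)$.
   Context: A hypergraph is a pair $H=(V,E)$ where $V$ is a finite set and $E$ is a finite multiset (parallel hyperedges are allowed and treated as distinct elements of $E$) of multisets of elements of $V$, called hyperedges. For $e\in E$, $d(e)$ is the size of $e$ counted with multiplicity; it is always assumed that $d(e)>1$. Write $v(H)=|V|$. $\kappa(H)$ is the number of connected components of the bipartite incidence graph with vertex classes $V$ and $E$, in which $u\in V$ and $e\in E$ are joined by as many edges as the multiplicity of $u$ in $e$. For $A\subseteq E$ let $\kappa(A)=\kappa((V,A))$, $d(A)=\sum_{e\in A}d(e)$, and $|A|$ is the number of hyperedges in $A$. Hypergraph Tutte polynomial: $T_{\mathrm{HG}}(H)=T_{\mathrm{HG}}(H;x,y)=\sum_{A\subseteq E}(x-1)^{\kappa(A)-\kappa(H)}(y-1)^{d(A)-|A|-v(H)+\kappa(A)}$. *)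

theory Defs
  imports "HOL-Library.Multiset" "HOL-Computational_Algebra.Polynomial"
begin

text \<open>
  The multiset of hyperedges is given by a set of edge names together with the multiset of
  vertices each name carries, so that parallel hyperedges remain distinct.
\<close>

record ('v, 'e) hgraph =
  verts :: "'v set"
  edges :: "'e set"
  ends :: "'e \<Rightarrow> 'v multiset"

definition hypergraph :: "('v, 'e) hgraph \<Rightarrow> bool" where
  "hypergraph H \<longleftrightarrow> finite (verts H) \<and> finite (edges H) \<and>
     (\<forall>e\<in>edges H. set_mset (ends H e) \<subseteq> verts H \<and> size (ends H e) > 1)"

definition inc_nodes :: "('v, 'e) hgraph \<Rightarrow> ('v + 'e) set" where
  "inc_nodes H = verts H <+> edges H"

text \<open>The third component numbers the parallel edges of the incidence graph.\<close>

definition inc_edges :: "('v, 'e) hgraph \<Rightarrow> ('v \<times> 'e \<times> nat) set" where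
  "inc_edges H = {(u, e, i). u \<in> verts H \<and> e \<in> edges H \<and> i < count (ends H e) u}"

definition inc_adj :: "('v, 'e) hgraph \<Rightarrow> ('v + 'e) rel" where
  "inc_adj H = {(Inl u, Inr e) | u e i. (u, e, i) \<in> inc_edges H}
             \<union> {(Inr e, Inl u) | u e i. (u, e, i) \<in> inc_edges H}"

definition inc_conn :: "('v, 'e) hgraph \<Rightarrow> ('v + 'e) rel" where
  "inc_conn H = (inc_adj H)\<^sup>* \<inter> inc_nodes H \<times> inc_nodes H"

definition kappa :: "('v, 'e) hgraph \<Rightarrow> nat" where
  "kappa H = card (inc_nodes H // inc_conn H)"

definition kappa_sub :: "('v, 'e) hgraph \<Rightarrow> 'e set \<Rightarrow> nat" where
  "kappa_sub H A = kappa (H\<lparr>edges := A\<rparr>)"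

definition edeg :: "('v, 'e) hgraph \<Rightarrow> 'e set \<Rightarrow> nat" where
  "edeg H A = (\<Sum>e\<in>A. size (ends H e))"

text \<open>
  Bivariate polynomials are polynomials in \<open>y\<close> whose coefficients are polynomials in \<open>x\<close>.
\<close>

definition tutte_x :: "int poly poly" where
  "tutte_x = [:[:0, 1:]:]"

definition tutte_y :: "int poly poly" where
  "tutte_y = [:0, 1:]"

text \<open>
  Both exponents are natural-number differences; \<open>kappa_le_kappa_sub\<close> and
  \<open>nullity_nonneg\<close> below show that neither subtraction truncates.
\<close>

definition tutte_HG :: "('v, 'e) hgraph \<Rightarrow> int poly poly" where
  "tutte_HG H = (\<Sum>A\<in>Pow (edges H).
     (tutte_x - 1) ^ (kappa_sub H A - kappa H) *
     (tutte_y - 1) ^ (edeg H A + kappa_sub H A - (card A + card (verts H))))"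

text \<open>Only meaningful for hypergraphs that are vertex- and edge-disjoint.\<close>

definition hg_union :: "('v, 'e) hgraph \<Rightarrow> ('v, 'e) hgraph \<Rightarrow> ('v, 'e) hgraph" where
  "hg_union H1 H2 = \<lparr>verts = verts H1 \<union> verts H2, edges = edges H1 \<union> edges H2,
     ends = (\<lambda>e. if e \<in> edges H1 then ends H1 e else ends H2 e)\<rparr>"

text \<open>
  The merged vertex is called \<open>v\<close>. It may be \<open>v1\<close>, \<open>v2\<close> or a fresh vertex, but not one of the
  remaining vertices.
\<close>

definition vertex_join ::
  "('v, 'e) hgraph \<Rightarrow> 'v \<Rightarrow> ('v, 'e) hgraph \<Rightarrow> 'v \<Rightarrow> 'v \<Rightarrow> ('v, 'e) hgraph" where
  "vertex_join H1 v1 H2 v2 v =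
     (let f = (\<lambda>u. if u = v1 \<or> u = v2 then v else u); H = hg_union H1 H2
      in \<lparr>verts = f ` verts H, edges = edges H, ends = (\<lambda>e. image_mset f (ends H e))\<rparr>)"

lemma sym_inc_adj: "sym (inc_adj H)"
  unfolding sym_def inc_adj_def by auto

lemma equiv_inc_conn: "equiv (inc_nodes H) (inc_conn H)"
proof (rule equivI)
  show "refl_on (inc_nodes H) (inc_conn H)"
    unfolding refl_on_def inc_conn_def by auto
  show "sym (inc_conn H)"
    using sym_rtrancl[OF sym_inc_adj] unfolding sym_def inc_conn_def by blast
  show "trans (inc_conn H)"
    unfolding trans_def inc_conn_def by (auto intro: rtrancl_trans)
qed (auto simp: inc_conn_def)

lemma hypergraph_sub:
  assumes "hypergraph H" "A \<subseteq> edges H"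
  shows "hypergraph (H\<lparr>edges := A\<rparr>)"
  using assms finite_subset unfolding hypergraph_def by auto

lemma finite_inc_nodes: "hypergraph H \<Longrightarrow> finite (inc_nodes H)"
  by (simp add: hypergraph_def inc_nodes_def)

lemma kappa_le_kappa_sub:
  assumes H: "hypergraph H" and A: "A \<subseteq> edges H"
  shows "kappa H \<le> kappa_sub H A"
proof -
  let ?G = "H\<lparr>edges := A\<rparr>"
  let ?P = "inc_nodes ?G // inc_conn ?G"
  have nod: "inc_nodes ?G \<subseteq> inc_nodes H"
    using A by (auto simp: inc_nodes_def)
  have "inc_adj ?G \<subseteq> inc_adj H"
    using A unfolding inc_adj_def inc_edges_def by auto
  then have sub: "inc_conn ?G \<subseteq> inc_conn H"
    using nod rtrancl_mono unfolding inc_conn_def by blast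
  have eq: "inc_conn H `` (inc_conn ?G `` {p}) = inc_conn H `` {p}" if "p \<in> inc_nodes ?G" for p
  proof -
    have "(p, p) \<in> inc_conn ?G" using that by (auto simp: inc_conn_def)
    moreover have "trans (inc_conn H)" using equiv_inc_conn equivE by blast
    ultimately show ?thesis using sub unfolding trans_def by blast
  qed
  have "inc_nodes H // inc_conn H \<subseteq> (\<lambda>C. inc_conn H `` C) ` ?P"
  proof
    fix C assume "C \<in> inc_nodes H // inc_conn H"
    then obtain p where p: "p \<in> inc_nodes H" "C = inc_conn H `` {p}"
      by (auto simp: quotient_def)
    have "\<exists>u\<in>verts H. (Inl u, p) \<in> inc_conn H"
    proof (cases p)
      case (Inl u)
      then show ?thesis using p(1) by (auto simp: inc_conn_def inc_nodes_def)
    next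
      case (Inr e)
      then have e: "e \<in> edges H" using p(1) by (auto simp: inc_nodes_def)
      then have "ends H e \<noteq> {#}" "set_mset (ends H e) \<subseteq> verts H"
        using H by (auto simp: hypergraph_def)
      then obtain u where u: "u \<in># ends H e" "u \<in> verts H" by blast
      then have "(u, e, 0) \<in> inc_edges H" using e by (simp add: inc_edges_def)
      then have "(Inl u, p) \<in> inc_adj H" using Inr by (auto simp: inc_adj_def)
      then have "(Inl u, p) \<in> inc_conn H"
        using u p(1) by (auto simp: inc_conn_def inc_nodes_def)
      then show ?thesis using u by blast
    qed
    then obtain u where u: "u \<in> verts H" "(Inl u, p) \<in> inc_conn H" by blast
    then have "C = inc_conn H `` {Inl u}"
      using p(2) equiv_class_eq[OF equiv_inc_conn] by blast
    moreover have un: "Inl u \<in> inc_nodes ?G" using u by (auto simp: inc_nodes_def)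
    ultimately have "C = inc_conn H `` (inc_conn ?G `` {Inl u})" using eq by simp
    then show "C \<in> (\<lambda>C. inc_conn H `` C) ` ?P" using un by (auto simp: quotient_def)
  qed
  moreover have "finite ?P"
    using finite_inc_nodes[OF hypergraph_sub[OF H A]] equiv_inc_conn finite_quotient
    by (metis equiv_type)
  ultimately show ?thesis
    unfolding kappa_def kappa_sub_def by (rule surj_card_le[rotated])
qed

lemma rtrancl_Un_sym_insert:
  assumes "(p, q) \<in> (insert (a, b) (insert (b, a) r))\<^sup>*"
  shows "(p, q) \<in> r\<^sup>* \<or> ((p, a) \<in> r\<^sup>* \<or> (p, b) \<in> r\<^sup>*) \<and> ((a, q) \<in> r\<^sup>* \<or> (b, q) \<in> r\<^sup>*)"
  using assms by (auto simp: rtrancl_insert)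

lemma card_components_ge:
  fixes f g :: "'i \<Rightarrow> 'n"
  assumes "finite N" "finite F"
  shows "card N \<le> card (N // (((\<lambda>i. (f i, g i)) ` F \<union> (\<lambda>i. (g i, f i)) ` F)\<^sup>* \<inter> N \<times> N)) + card F"
  using assms(2)
proof (induction F rule: finite_induct)
  case empty
  have "N // (Id \<inter> N \<times> N) = (\<lambda>x. {x}) ` N" by (auto simp: quotient_def)
  then have "card (N // (Id \<inter> N \<times> N)) = card N" by (simp add: card_image)
  then show ?case by simp
next
  case (insert j F)
  define r where "r = (\<lambda>i. (f i, g i)) ` F \<union> (\<lambda>i. (g i, f i)) ` F"
  define s where "s = insert (f j, g j) (insert (g j, f j) r)"
  let ?R = "r\<^sup>* \<inter> N \<times> N" and ?S = "s\<^sup>* \<inter> N \<times> N"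
  have symr: "sym (r\<^sup>*)" by (rule sym_rtrancl) (auto simp: sym_def r_def)
  have rs: "r\<^sup>* \<subseteq> s\<^sup>*" by (rule rtrancl_mono) (auto simp: s_def)
  have finS: "finite (N // ?S)" using assms(1) by (intro finite_quotient) auto
  have finR: "finite (N // ?R)" using assms(1) by (intro finite_quotient) auto
  let ?h = "\<lambda>C. ?S `` C"
  let ?a = "{C \<in> N // ?R. \<exists>p\<in>C. (f j, p) \<in> r\<^sup>*}"
  have cls: "?R `` {p} = ?R `` {q}" if "(p, q) \<in> r\<^sup>*" "p \<in> N" "q \<in> N" for p q
  proof -
    have "(q, p) \<in> r\<^sup>*" using symr that(1) by (rule symD)
    then have "(p, z) \<in> r\<^sup>* \<longleftrightarrow> (q, z) \<in> r\<^sup>*" for z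
      using that(1) by (meson rtrancl_trans)
    then show ?thesis using that by auto
  qed
  have hR: "?h (?R `` {p}) = ?S `` {p}" if "p \<in> N" for p
  proof (intro equalityI subsetI)
    fix z assume "z \<in> ?h (?R `` {p})"
    then obtain w where w: "(p, w) \<in> r\<^sup>*" "(w, z) \<in> s\<^sup>*" "z \<in> N" by auto
    then have "(p, z) \<in> s\<^sup>*" using rs by (meson rtrancl_trans subsetD)
    then show "z \<in> ?S `` {p}" using that w by simp
  next
    fix z assume "z \<in> ?S `` {p}"
    then show "z \<in> ?h (?R `` {p})" using that by blast
  qed
  have a1: "card ?a \<le> 1"
  proof -
    have "C = D" if C: "C \<in> ?a" and D: "D \<in> ?a" for C D
    proof -
      from C obtain x p where x: "x \<in> N" "C = ?R `` {x}" "(x, p) \<in> r\<^sup>*" "(f j, p) \<in> r\<^sup>*"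
        by (auto simp: quotient_def)
      from D obtain y q where y: "y \<in> N" "D = ?R `` {y}" "(y, q) \<in> r\<^sup>*" "(f j, q) \<in> r\<^sup>*"
        by (auto simp: quotient_def)
      have "(x, y) \<in> r\<^sup>*"
        using x y symr unfolding sym_def by (meson rtrancl_trans)
      then show "C = D" using cls x y by simp
    qed
    moreover have "finite ?a" using finR by simp
    ultimately show ?thesis by (simp only: card_le_Suc0_iff_eq One_nat_def) blast
  qed
  have inj: "inj_on ?h (N // ?R - ?a)"
  proof (rule inj_onI)
    fix C D assume C: "C \<in> N // ?R - ?a" and D: "D \<in> N // ?R - ?a" and eq: "?h C = ?h D"
    from C obtain x where x: "x \<in> N" "C = ?R `` {x}" by (auto simp: quotient_def)
    from D obtain y where y: "y \<in> N" "D = ?R `` {y}" by (auto simp: quotient_def)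
    have nx: "(f j, x) \<notin> r\<^sup>*" using C x by auto
    have ny: "(f j, y) \<notin> r\<^sup>*" using D y by auto
    have "?S `` {x} = ?S `` {y}" using eq hR x y by simp
    then have "(x, y) \<in> s\<^sup>*" using y(1) by blast
    then have "(x, y) \<in> r\<^sup>*"
      using rtrancl_Un_sym_insert[of x y "f j" "g j" r] nx ny symr
      unfolding s_def by (metis rtrancl_trans symD)
    then show "C = D" using cls x y by simp
  qed
  have "?h ` (N // ?R - ?a) \<subseteq> N // ?S"
    using hR by (auto simp: quotient_def)
  then have "card (N // ?R - ?a) \<le> card (N // ?S)"
    using inj finS card_inj_on_le by blast
  moreover have "card (N // ?R) \<le> card (N // ?R - ?a) + card ?a"
    using finR by (subst card_Diff_subset) auto
  ultimately have "card (N // ?R) \<le> card (N // ?S) + 1" using a1 by linarith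
  moreover have "s = (\<lambda>i. (f i, g i)) ` insert j F \<union> (\<lambda>i. (g i, f i)) ` insert j F"
    by (auto simp: s_def r_def)
  ultimately show ?case using insert r_def by simp
qed

lemma inc_edges_eq:
  assumes "hypergraph H"
  shows "finite (inc_edges H)" "card (inc_edges H) = edeg H (edges H)"
proof -
  have fin: "finite (verts H)" "finite (edges H)" using assms by (auto simp: hypergraph_def)
  let ?S = "SIGMA e:edges H. SIGMA u:verts H. {..<count (ends H e) u}"
  have eq: "inc_edges H = (\<lambda>(e, u, i). (u, e, i)) ` ?S"
    by (auto simp: inc_edges_def image_iff)
  have inj: "inj_on (\<lambda>(e, u, i). (u, e, i)) ?S" by (auto simp: inj_on_def)
  show "finite (inc_edges H)" unfolding eq using fin by auto
  have "card (inc_edges H) = card ?S" unfolding eq by (rule card_image[OF inj])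
  also have "\<dots> = (\<Sum>e\<in>edges H. \<Sum>u\<in>verts H. count (ends H e) u)"
    using fin by simp
  also have "\<dots> = edeg H (edges H)"
    unfolding edeg_def
  proof (rule sum.cong)
    fix e assume "e \<in> edges H"
    then have "set_mset (ends H e) \<subseteq> verts H" using assms by (auto simp: hypergraph_def)
    then show "(\<Sum>u\<in>verts H. count (ends H e) u) = size (ends H e)"
      unfolding size_multiset_overloaded_eq using fin
      by (intro sum.mono_neutral_right) (auto simp: not_in_iff)
  qed simp
  finally show "card (inc_edges H) = edeg H (edges H)" .
qed

lemma nullity_nonneg:
  assumes H: "hypergraph H" and A: "A \<subseteq> edges H"
  shows "card A + card (verts H) \<le> edeg H A + kappa_sub H A"
proof -
  let ?G = "H\<lparr>edges := A\<rparr>"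
  have G: "hypergraph ?G" using H A by (rule hypergraph_sub)
  let ?f = "\<lambda>(u, e, i). Inl u" and ?g = "\<lambda>(u, e, i). Inr e"
  have adj: "inc_adj ?G = (\<lambda>t. (?f t, ?g t)) ` inc_edges ?G \<union> (\<lambda>t. (?g t, ?f t)) ` inc_edges ?G"
    unfolding inc_adj_def by (force simp: image_iff)
  have "card (inc_nodes ?G) \<le> kappa ?G + card (inc_edges ?G)"
    unfolding kappa_def inc_conn_def adj
    by (rule card_components_ge[OF finite_inc_nodes[OF G] inc_edges_eq(1)[OF G]])
  moreover have "card (inc_nodes ?G) = card (verts H) + card A"
    using G by (simp add: inc_nodes_def card_Plus hypergraph_def)
  moreover have "card (inc_edges ?G) = edeg H A"
    using inc_edges_eq(2)[OF G] by (simp add: edeg_def)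
  ultimately show ?thesis by (simp add: kappa_sub_def)
qed

lemma hypergraph_hg_union:
  assumes "hypergraph H1" "hypergraph H2"
  shows "hypergraph (hg_union H1 H2)"
  using assms unfolding hypergraph_def hg_union_def by auto

lemma hypergraph_vertex_join:
  assumes "hypergraph H1" "hypergraph H2"
  shows "hypergraph (vertex_join H1 v1 H2 v2 v)"
  using hypergraph_hg_union[OF assms] unfolding hypergraph_def vertex_join_def Let_def
  by auto

end

theory Submission
  imports Defs
begin

text \<open>
  Subsets of \<open>E\<^sub>1 \<union> E\<^sub>2\<close> are unions \<open>A\<^sub>1 \<union> A\<^sub>2\<close>, so the product formula follows termwise
  once both exponents are additive. Degrees and cardinalities of edge sets are additive. For the
  disjoint union, so are the number of vertices and the number of components; for the vertex join,
  both drop by exactly one against the disjoint union (the two glued vertices lie in different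
  components), and this common defect cancels in both exponents.
\<close>

section \<open>Component counts under disjoint union and under gluing of two points\<close>

text \<open>The assignment sending \<open>f x\<close> to \<open>g x\<close> is well defined and
  injective. This allows classes to be counted through any labelling of points that separates the
  same pairs.\<close>

lemma card_image_eq_kernel:
  assumes "\<And>x y. x \<in> M \<Longrightarrow> y \<in> M \<Longrightarrow> f x = f y \<longleftrightarrow> g x = g y"
  shows "card (f ` M) = card (g ` M)"
proof -
  have "bij_betw (\<lambda>z. g (inv_into M f z)) (f ` M) (g ` M)"
    unfolding bij_betw_def
  proof
    show "inj_on (\<lambda>z. g (inv_into M f z)) (f ` M)"
      by (rule inj_onI) (metis assms f_inv_into_f inv_into_into)
    have "g (inv_into M f (f x)) = g x" if "x \<in> M" for x
      by (metis assms f_inv_into_f imageI inv_into_into that)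
    then show "(\<lambda>z. g (inv_into M f z)) ` f ` M = g ` M"
      by (simp add: image_image)
  qed
  then show ?thesis by (rule bij_betw_same_card)
qed

lemma quotient_eq_image: "M // R = (\<lambda>x. R `` {x}) ` M"
  by (auto simp: quotient_def)

lemma equiv_rtrancl_on:
  assumes "sym r"
  shows "equiv M (r\<^sup>* \<inter> M \<times> M)"
proof (rule equivI)
  show "sym (r\<^sup>* \<inter> M \<times> M)"
    using sym_rtrancl[OF assms] unfolding sym_def by blast
  show "trans (r\<^sup>* \<inter> M \<times> M)"
    unfolding trans_def by (auto intro: rtrancl_trans)
qed (auto simp: refl_on_def)

text \<open>A path that starts in \<open>M\<close> can never take an \<open>s\<close>-step, since
  such a step would have to start in \<open>N\<close>.\<close>

lemma rtrancl_Un_disjoint: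
  assumes "(x, y) \<in> (r \<union> s)\<^sup>*" "x \<in> M" "r \<subseteq> M \<times> M" "s \<subseteq> N \<times> N" "M \<inter> N = {}"
  shows "y \<in> M \<and> (x, y) \<in> r\<^sup>*"
  using assms(1)
proof (induction rule: rtrancl_induct)
  case base
  then show ?case using assms by simp
next
  case (step y z)
  then have "(y, z) \<in> r" using assms by blast
  then show ?case using step assms by (meson SigmaD2 rtrancl.rtrancl_into_rtrancl subsetD)
qed

text \<open>No path crosses between \<open>M\<close> and \<open>N\<close>, so each class of the
  union is a class of one side. The two families of classes share no member because classes are
  nonempty and stay within their side.\<close>

lemma card_components_disjoint:
  assumes "finite M" "finite N" "M \<inter> N = {}" "r \<subseteq> M \<times> M" "s \<subseteq> N \<times> N"
  shows "card ((M \<union> N) // ((r \<union> s)\<^sup>* \<inter> (M \<union> N) \<times> (M \<union> N))) =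
    card (M // (r\<^sup>* \<inter> M \<times> M)) + card (N // (s\<^sup>* \<inter> N \<times> N))"
proof -
  let ?T = "(r \<union> s)\<^sup>* \<inter> (M \<union> N) \<times> (M \<union> N)"
  let ?R = "r\<^sup>* \<inter> M \<times> M" and ?S = "s\<^sup>* \<inter> N \<times> N"
  have mono: "r\<^sup>* \<subseteq> (r \<union> s)\<^sup>*" "s\<^sup>* \<subseteq> (r \<union> s)\<^sup>*" by (auto intro!: rtrancl_mono)
  have M: "?T `` {x} = ?R `` {x}" if "x \<in> M" for x
    using rtrancl_Un_disjoint[of x _ r s M N] mono that assms by blast
  have N: "?T `` {x} = ?S `` {x}" if "x \<in> N" for x
    using rtrancl_Un_disjoint[of x _ s r N M] mono that assms
    by (auto simp: Un_commute Int_commute)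
  have eq: "(M \<union> N) // ?T = M // ?R \<union> N // ?S"
    unfolding quotient_eq_image image_Un using M N by simp
  have "C \<notin> N // ?S" if "C \<in> M // ?R" for C
  proof
    assume "C \<in> N // ?S"
    then have "C \<subseteq> N" by (auto simp: quotient_def)
    moreover have "C \<inter> M \<noteq> {}" using that by (auto simp: quotient_def)
    ultimately show False using assms by blast
  qed
  then have "M // ?R \<inter> N // ?S = {}" by blast
  moreover have "finite (M // ?R)" "finite (N // ?S)"
    using assms by (auto intro!: finite_quotient)
  ultimately show ?thesis unfolding eq by (rule card_Un_disjoint[rotated 2])
qed

text \<open>Gluing \<open>a\<close> to \<open>b\<close> merges their two classes and leaves the
  others apart. The classes after gluing are counted by labels in the old quotient, where exactly
  one old class, that of \<open>a\<close>, is no longer used.\<close>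

lemma card_components_identify:
  fixes q :: "'a \<Rightarrow> 'b"
  assumes fin: "finite M" and sym: "sym r" and r: "r \<subseteq> M \<times> M"
    and ab: "a \<in> M" "b \<in> M" "(a, b) \<notin> r\<^sup>*" "q a = q b"
    and inj: "\<And>x y. x \<in> M \<Longrightarrow> y \<in> M \<Longrightarrow> q x = q y \<Longrightarrow> x = y \<or> {x, y} = {a, b}"
  shows "card (M // (r\<^sup>* \<inter> M \<times> M)) =
    card (q ` M // ((map_prod q q ` r)\<^sup>* \<inter> q ` M \<times> q ` M)) + 1"
proof -
  let ?R = "r\<^sup>* \<inter> M \<times> M" and ?s = "map_prod q q ` r"
  let ?S = "?s\<^sup>* \<inter> q ` M \<times> q ` M"
  \<comment> \<open>The label of \<open>x\<close> is its old class, except that the class of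
    \<open>a\<close> is redirected to that of \<open>b\<close>. Two points get equal labels exactly
    when their images under \<open>q\<close> are connected, which \<open>fwd\<close> and
    \<open>bwd\<close> establish.\<close>
  define c where "c x = (if (x, a) \<in> r\<^sup>* then ?R `` {b} else ?R `` {x})" for x
  have syms: "sym ?s" using sym unfolding sym_def by force
  note eqR = eq_equiv_class_iff[OF equiv_rtrancl_on[OF sym]]
  have symr: "(x, y) \<in> r\<^sup>* \<Longrightarrow> (y, x) \<in> r\<^sup>*" for x y
    using sym_rtrancl[OF sym] by (rule symD)
  have cc: "c x = c y" if "(x, y) \<in> r\<^sup>*" "x \<in> M" "y \<in> M" for x y
  proof -
    have "(x, a) \<in> r\<^sup>* \<longleftrightarrow> (y, a) \<in> r\<^sup>*" using that symr by (meson rtrancl_trans)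
    moreover have "?R `` {x} = ?R `` {y}" using that by (subst eqR) auto
    ultimately show ?thesis by (simp add: c_def)
  qed
  have "(b, a) \<notin> r\<^sup>*" using ab symr by blast
  then have cab: "c a = c b" by (simp add: c_def)
  have cq: "c x = c y" if "x \<in> M" "y \<in> M" "q x = q y" for x y
    using inj[OF that] cab by (auto simp: doubleton_eq_iff)
  have fwd: "c x = c y" if "(q x, q y) \<in> ?s\<^sup>*" "x \<in> M" "y \<in> M" for x y
  proof -
    \<comment> \<open>Consecutive steps of an image path need not lift to a path in
      \<open>r\<close>: the lifts may jump between \<open>a\<close> and \<open>b\<close>. The label
      is constant along lifted steps by \<open>cc\<close> and across such jumps by
      \<open>cq\<close>, so it is the invariant carried along.\<close>
    have "\<exists>w\<in>M. q w = z \<and> c x = c w" if "(q x, z) \<in> ?s\<^sup>*" for z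
      using that
    proof (induction rule: rtrancl_induct)
      case base
      then show ?case using \<open>x \<in> M\<close> by blast
    next
      case (step z z')
      then obtain w u u' where w: "w \<in> M" "q w = z" "c x = c w"
        and u: "(u, u') \<in> r" "z = q u" "z' = q u'" by auto
      have "u \<in> M" "u' \<in> M" using u r by auto
      then have "c x = c u'" using w u cq[of w u] cc[of u u'] by auto
      then show ?case using u \<open>u' \<in> M\<close> by blast
    qed
    then show ?thesis using that cq by metis
  qed
  have lift: "(q x, q y) \<in> ?s\<^sup>*" if "(x, y) \<in> r\<^sup>*" for x y
    using that
  proof (induction rule: rtrancl_induct)
    case (step y z)
    then have "(q y, q z) \<in> ?s" by force
    then show ?case using step by (meson rtrancl.rtrancl_into_rtrancl)
  qed simp
  have bwd: "(q x, q y) \<in> ?s\<^sup>*" if "c x = c y" "x \<in> M" "y \<in> M" for x y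
  proof -
    \<comment> \<open>The representative \<open>z\<close> is \<open>b\<close> if \<open>x\<close>
      reaches \<open>a\<close>, where \<open>q a = q b\<close> supplies the connection, and
      \<open>x\<close> itself otherwise.\<close>
    have rep: "\<exists>z\<in>M. c x = ?R `` {z} \<and> (q x, q z) \<in> ?s\<^sup>*" if "x \<in> M" for x
    proof (cases "(x, a) \<in> r\<^sup>*")
      case True
      then show ?thesis using lift[OF True] ab by (auto simp: c_def)
    next
      case False
      then show ?thesis using that by (auto simp: c_def)
    qed
    obtain z where z: "z \<in> M" "c x = ?R `` {z}" "(q x, q z) \<in> ?s\<^sup>*"
      using rep[OF \<open>x \<in> M\<close>] by blast
    obtain w where w: "w \<in> M" "c y = ?R `` {w}" "(q y, q w) \<in> ?s\<^sup>*"
      using rep[OF \<open>y \<in> M\<close>] by blast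
    have "(z, w) \<in> r\<^sup>*" using that z w eqR[of z M w] by simp
    then have "(q z, q w) \<in> ?s\<^sup>*" by (rule lift)
    moreover have "(q w, q y) \<in> ?s\<^sup>*" using w sym_rtrancl[OF syms] by (meson symD)
    ultimately show ?thesis using z by (meson rtrancl_trans)
  qed
  have "card (q ` M // ?S) = card ((\<lambda>x. ?S `` {q x}) ` M)"
    unfolding quotient_eq_image image_image ..
  also have "\<dots> = card (c ` M)"
  proof (rule card_image_eq_kernel)
    fix x y assume xy: "x \<in> M" "y \<in> M"
    then have "?S `` {q x} = ?S `` {q y} \<longleftrightarrow> (q x, q y) \<in> ?S"
      by (intro eq_equiv_class_iff[OF equiv_rtrancl_on[OF syms]]) auto
    then show "?S `` {q x} = ?S `` {q y} \<longleftrightarrow> c x = c y"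
      using xy fwd[of x y] bwd[of x y] by auto
  qed
  \<comment> \<open>The class of \<open>a\<close> is missed because its own points are labelled by
    the class of \<open>b\<close>, which differs from it as \<open>(b, a)\<close> is not in
    \<open>r\<^sup>*\<close>.\<close>
  also have "c ` M = M // ?R - {?R `` {a}}"
  proof (intro equalityI subsetI)
    fix C assume "C \<in> c ` M"
    then obtain x where x: "x \<in> M" "C = c x" by blast
    show "C \<in> M // ?R - {?R `` {a}}"
    proof (cases "(x, a) \<in> r\<^sup>*")
      case True
      then show ?thesis using x ab \<open>(b, a) \<notin> r\<^sup>*\<close> eqR[of b M a]
        by (auto simp: c_def intro!: quotientI)
    next
      case False
      then show ?thesis using x ab eqR[of x M a]
        by (auto simp: c_def intro!: quotientI)
    qed
  next
    fix C assume C: "C \<in> M // ?R - {?R `` {a}}"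
    then obtain x where x: "x \<in> M" "C = ?R `` {x}" by (auto simp: quotient_def)
    then have "(x, a) \<notin> r\<^sup>*" using C ab eqR[of x M a] by auto
    then show "C \<in> c ` M" using x by (auto simp: c_def)
  qed
  finally have "card (q ` M // ?S) = card (M // ?R - {?R `` {a}})" .
  moreover have "?R `` {a} \<in> M // ?R" using ab by (intro quotientI)
  moreover have "finite (M // ?R)" using fin by (intro finite_quotient) auto
  ultimately show ?thesis
    by (metis Suc_eq_plus1 card_Suc_Diff1)
qed

section \<open>Incidence graphs of the disjoint union and of the vertex join\<close>

text \<open>Adjacency only asks for a positive multiplicity. Without the edge numbers the
  description is compatible with \<open>image_mset f\<close>, which may add up
  multiplicities.\<close>

lemma inc_adj_iff:
  "inc_adj H = {(Inl u, Inr e) | u e. u \<in> verts H \<and> e \<in> edges H \<and> u \<in># ends H e}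
             \<union> {(Inr e, Inl u) | u e. u \<in> verts H \<and> e \<in> edges H \<and> u \<in># ends H e}"
  unfolding inc_adj_def inc_edges_def by (auto simp flip: count_greater_zero_iff)

lemma inc_adj_subset: "inc_adj H \<subseteq> inc_nodes H \<times> inc_nodes H"
  by (auto simp: inc_adj_iff inc_nodes_def)

lemma inc_nodes_map:
  assumes "verts J = f ` verts U" "edges J = edges U"
  shows "inc_nodes J = map_sum f id ` inc_nodes U"
  unfolding inc_nodes_def assms Plus_def image_Un image_image by simp

text \<open>Each end of an edge of \<open>J\<close> is \<open>f w\<close> for an end
  \<open>w\<close> of the same edge of \<open>U\<close>, and \<open>hypergraph U\<close> places
  \<open>w\<close> in \<open>verts U\<close>. Hence every incidence of \<open>J\<close>
  lifts.\<close>

lemma inc_adj_map: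
  assumes U: "hypergraph U"
    and J: "verts J = f ` verts U" "edges J = edges U" "ends J = (\<lambda>e. image_mset f (ends U e))"
  shows "inc_adj J = map_prod (map_sum f id) (map_sum f id) ` inc_adj U"
proof (intro equalityI subsetI)
  fix p assume "p \<in> inc_adj J"
  then consider u e where "p = (Inl u, Inr e)" "e \<in> edges J" "u \<in># ends J e"
    | u e where "p = (Inr e, Inl u)" "e \<in> edges J" "u \<in># ends J e"
    unfolding inc_adj_iff by blast
  then show "p \<in> map_prod (map_sum f id) (map_sum f id) ` inc_adj U"
  proof cases
    case 1
    then obtain w where w: "w \<in># ends U e" "u = f w" "e \<in> edges U" unfolding J by auto
    then have "(Inl w, Inr e) \<in> inc_adj U" using U by (auto simp: inc_adj_iff hypergraph_def)
    then show ?thesis using 1 w by (intro image_eqI) simp_all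
  next
    case 2
    then obtain w where w: "w \<in># ends U e" "u = f w" "e \<in> edges U" unfolding J by auto
    then have "(Inr e, Inl w) \<in> inc_adj U" using U by (auto simp: inc_adj_iff hypergraph_def)
    then show ?thesis using 2 w by (intro image_eqI) simp_all
  qed
next
  fix p assume "p \<in> map_prod (map_sum f id) (map_sum f id) ` inc_adj U"
  then show "p \<in> inc_adj J" by (auto simp: inc_adj_iff J)
qed

lemma kappa_eq_kappa_sub: "kappa H = kappa_sub H (edges H)"
  by (simp add: kappa_sub_def)

locale disjoint_hypergraphs =
  fixes H1 H2 :: "('v, 'e) hgraph"
  assumes H1: "hypergraph H1" and H2: "hypergraph H2"
    and disj_verts: "verts H1 \<inter> verts H2 = {}" and disj_edges: "edges H1 \<inter> edges H2 = {}"
begin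

lemma inc_union_sub:
  assumes A: "A1 \<subseteq> edges H1" "A2 \<subseteq> edges H2"
  defines "U \<equiv> (hg_union H1 H2)\<lparr>edges := A1 \<union> A2\<rparr>"
    and "G1 \<equiv> H1\<lparr>edges := A1\<rparr>" and "G2 \<equiv> H2\<lparr>edges := A2\<rparr>"
  shows "inc_nodes U = inc_nodes G1 \<union> inc_nodes G2"
    and "inc_adj U = inc_adj G1 \<union> inc_adj G2"
    and "inc_nodes G1 \<inter> inc_nodes G2 = {}"
    and "finite (inc_nodes G1)" and "finite (inc_nodes G2)"
proof -
  show "inc_nodes U = inc_nodes G1 \<union> inc_nodes G2"
    by (auto simp: U_def G1_def G2_def inc_nodes_def hg_union_def)
  show "inc_nodes G1 \<inter> inc_nodes G2 = {}"
    using disj_verts disj_edges A by (auto simp: G1_def G2_def inc_nodes_def)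
  \<comment> \<open>Edges have their ends on their own side, so there are no cross incidences. Edges
    of \<open>A2\<close> lie outside \<open>edges H1\<close>, so the conditional in
    \<open>hg_union\<close> selects \<open>ends H2\<close> for them.\<close>
  have "set_mset (ends H1 e) \<subseteq> verts H1" if "e \<in> A1" for e
    using H1 A that by (auto simp: hypergraph_def)
  moreover have "set_mset (ends H2 e) \<subseteq> verts H2" "e \<notin> edges H1" if "e \<in> A2" for e
    using H2 A that disj_edges by (auto simp: hypergraph_def)
  ultimately show "inc_adj U = inc_adj G1 \<union> inc_adj G2"
    using A by (fastforce simp: U_def G1_def G2_def inc_adj_iff hg_union_def)
  show "finite (inc_nodes G1)" "finite (inc_nodes G2)"
    unfolding G1_def G2_def
    using finite_inc_nodes hypergraph_sub H1 H2 A by blast+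
qed

lemma kappa_sub_hg_union:
  assumes "A1 \<subseteq> edges H1" "A2 \<subseteq> edges H2"
  shows "kappa_sub (hg_union H1 H2) (A1 \<union> A2) = kappa_sub H1 A1 + kappa_sub H2 A2"
  unfolding kappa_sub_def kappa_def inc_conn_def inc_union_sub(1,2)[OF assms]
  by (rule card_components_disjoint) (use inc_union_sub[OF assms] inc_adj_subset in blast)+

text \<open>The incidence graph of the join is that of the disjoint union with \<open>Inl v1\<close>
  and \<open>Inl v2\<close> glued, and these lie in different components because no path leaves the
  side of \<open>H1\<close>.\<close>

lemma kappa_sub_vertex_join:
  assumes v: "v1 \<in> verts H1" "v2 \<in> verts H2" "v \<notin> verts H1 \<union> verts H2 - {v1, v2}"
    and A: "A1 \<subseteq> edges H1" "A2 \<subseteq> edges H2"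
  shows "kappa_sub (vertex_join H1 v1 H2 v2 v) (A1 \<union> A2) + 1 = kappa_sub H1 A1 + kappa_sub H2 A2"
proof -
  let ?U = "(hg_union H1 H2)\<lparr>edges := A1 \<union> A2\<rparr>"
  let ?J = "(vertex_join H1 v1 H2 v2 v)\<lparr>edges := A1 \<union> A2\<rparr>"
  let ?f = "\<lambda>u. if u = v1 \<or> u = v2 then v else u"
  let ?q = "map_sum ?f id :: 'v + 'e \<Rightarrow> 'v + 'e"
  note U = inc_union_sub[OF A]
  have hU: "hypergraph ?U"
    by (rule hypergraph_sub[OF hypergraph_hg_union[OF H1 H2]])
       (use A in \<open>auto simp: hg_union_def\<close>)
  have J: "verts ?J = ?f ` verts ?U" "edges ?J = edges ?U"
    "ends ?J = (\<lambda>e. image_mset ?f (ends ?U e))"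
    by (simp_all add: vertex_join_def Let_def)
  note nodes = inc_nodes_map[OF J(1,2)] and adj = inc_adj_map[OF hU J]
  have v_in: "Inl v1 \<in> inc_nodes (H1\<lparr>edges := A1\<rparr>)" "Inl v2 \<in> inc_nodes (H2\<lparr>edges := A2\<rparr>)"
    using v by (auto simp: inc_nodes_def)
  have "kappa ?U = kappa ?J + 1"
    unfolding kappa_def inc_conn_def nodes adj
  proof (rule card_components_identify)
    show "finite (inc_nodes ?U)" using U by simp
    show "Inl v1 \<in> inc_nodes ?U" "Inl v2 \<in> inc_nodes ?U" using U(1) v_in by auto
    show "(Inl v1, Inl v2) \<notin> (inc_adj ?U)\<^sup>*"
    proof
      assume "(Inl v1, Inl v2) \<in> (inc_adj ?U)\<^sup>*"
      then have "Inl v2 \<in> inc_nodes (H1\<lparr>edges := A1\<rparr>)"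
        using rtrancl_Un_disjoint[OF _ v_in(1) inc_adj_subset inc_adj_subset U(3)] U(2) by simp
      then show False using v_in U(3) by blast
    qed
    fix x y assume "x \<in> inc_nodes ?U" "y \<in> inc_nodes ?U" "?q x = ?q y"
    \<comment> \<open>The condition on \<open>v\<close> keeps it apart from all remaining vertices,
      so \<open>?q\<close> identifies no other pair.\<close>
    then show "x = y \<or> {x, y} = {Inl v1, Inl v2}"
      using v by (auto simp: inc_nodes_def hg_union_def split: if_splits)
  qed (use sym_inc_adj inc_adj_subset in auto)
  then show ?thesis
    using kappa_sub_hg_union[OF A] by (simp add: kappa_sub_def)
qed

section \<open>Multiplicativity of the Tutte polynomial\<close>

text \<open>Both constructions are instances: \<open>c\<close> is the common drop in vertices and
  components, 0 for the union and 1 for the join. The map \<open>ends K\<close> enters the degrees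
  only through sizes, which renaming vertices preserves.\<close>

lemma tutte_HG_mult:
  assumes E: "edges K = edges H1 \<union> edges H2"
    and V: "card (verts K) + c = card (verts H1) + card (verts H2)"
    and sz: "\<And>e. e \<in> edges H1 \<Longrightarrow> size (ends K e) = size (ends H1 e)"
      "\<And>e. e \<in> edges H2 \<Longrightarrow> size (ends K e) = size (ends H2 e)"
    and k: "\<And>A1 A2. A1 \<subseteq> edges H1 \<Longrightarrow> A2 \<subseteq> edges H2 \<Longrightarrow>
      kappa_sub K (A1 \<union> A2) + c = kappa_sub H1 A1 + kappa_sub H2 A2"
  shows "tutte_HG K = tutte_HG H1 * tutte_HG H2"
proof -
  let ?t = "\<lambda>H A. (tutte_x - 1) ^ (kappa_sub H A - kappa H) *
     (tutte_y - 1) ^ (edeg H A + kappa_sub H A - (card A + card (verts H)))"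
  have t: "?t K (A1 \<union> A2) = ?t H1 A1 * ?t H2 A2"
    if A: "A1 \<subseteq> edges H1" "A2 \<subseteq> edges H2" for A1 A2
  proof -
    have fin: "finite A1" "finite A2" and dis: "A1 \<inter> A2 = {}"
      using A H1 H2 disj_edges by (auto simp: hypergraph_def intro: finite_subset)
    have "edeg K A1 = edeg H1 A1" "edeg K A2 = edeg H2 A2"
      using A sz unfolding edeg_def by (auto intro!: sum.cong)
    then have deg: "edeg K (A1 \<union> A2) = edeg H1 A1 + edeg H2 A2"
      using sum.union_disjoint[OF fin dis, of "\<lambda>e. size (ends K e)"] by (simp add: edeg_def)
    have crd: "card (A1 \<union> A2) = card A1 + card A2"
      using fin dis by (rule card_Un_disjoint)
    have k0: "kappa K + c = kappa H1 + kappa H2"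
      using k[of "edges H1" "edges H2"] E by (simp add: kappa_eq_kappa_sub)
    \<comment> \<open>These bounds make the natural-number differences for \<open>H1\<close> and
      \<open>H2\<close> exact. Together with the additive identities they do the same for
      \<open>K\<close>, so the exponent identities are linear arithmetic.\<close>
    note le = kappa_le_kappa_sub[OF H1 A(1)] kappa_le_kappa_sub[OF H2 A(2)]
      nullity_nonneg[OF H1 A(1)] nullity_nonneg[OF H2 A(2)]
    have x: "kappa_sub K (A1 \<union> A2) - kappa K =
        (kappa_sub H1 A1 - kappa H1) + (kappa_sub H2 A2 - kappa H2)"
      using k[OF A] k0 le by linarith
    have y: "edeg K (A1 \<union> A2) + kappa_sub K (A1 \<union> A2) - (card (A1 \<union> A2) + card (verts K)) =
        (edeg H1 A1 + kappa_sub H1 A1 - (card A1 + card (verts H1))) +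
        (edeg H2 A2 + kappa_sub H2 A2 - (card A2 + card (verts H2)))"
      using k[OF A] V le deg crd by linarith
    show ?thesis unfolding x y power_add by (simp only: mult_ac)
  qed
  have bij: "bij_betw (\<lambda>(A1, A2). A1 \<union> A2) (Pow (edges H1) \<times> Pow (edges H2)) (Pow (edges K))"
    by (rule bij_betw_byWitness[where f' = "\<lambda>A. (A \<inter> edges H1, A \<inter> edges H2)"])
       (use E disj_edges in auto)
  have "tutte_HG K = (\<Sum>(A1, A2) \<in> Pow (edges H1) \<times> Pow (edges H2). ?t K (A1 \<union> A2))"
    unfolding tutte_HG_def sum.reindex_bij_betw[OF bij, symmetric] by (simp add: case_prod_beta)
  also have "\<dots> = (\<Sum>(A1, A2) \<in> Pow (edges H1) \<times> Pow (edges H2). ?t H1 A1 * ?t H2 A2)"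
    by (rule sum.cong[OF refl]) (clarsimp simp only: mem_Times_iff Pow_iff fst_conv snd_conv t)
  also have "\<dots> = tutte_HG H1 * tutte_HG H2"
    unfolding tutte_HG_def sum_product sum.cartesian_product ..
  finally show ?thesis .
qed

lemma tutte_HG_union: "tutte_HG (hg_union H1 H2) = tutte_HG H1 * tutte_HG H2"
proof (rule tutte_HG_mult[where c = 0])
  show "card (verts (hg_union H1 H2)) + 0 = card (verts H1) + card (verts H2)"
    using H1 H2 disj_verts by (simp add: hg_union_def hypergraph_def card_Un_disjoint)
qed (use kappa_sub_hg_union disj_edges in \<open>auto simp: hg_union_def\<close>)

lemma tutte_HG_vertex_join:
  assumes v: "v1 \<in> verts H1" "v2 \<in> verts H2" "v \<notin> verts H1 \<union> verts H2 - {v1, v2}"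
  shows "tutte_HG (vertex_join H1 v1 H2 v2 v) = tutte_HG H1 * tutte_HG H2"
proof (rule tutte_HG_mult[where c = 1])
  \<comment> \<open>Written this way, \<open>v\<close> is new to the rest even if it equals
    \<open>v1\<close> or \<open>v2\<close>, so one vertex is lost from each side and a single one is
    added back.\<close>
  have "verts (vertex_join H1 v1 H2 v2 v) = insert v ((verts H1 - {v1}) \<union> (verts H2 - {v2}))"
    using v disj_verts by (auto simp: vertex_join_def hg_union_def)
  moreover have "card (insert v ((verts H1 - {v1}) \<union> (verts H2 - {v2}))) =
      Suc (card (verts H1 - {v1}) + card (verts H2 - {v2}))"
    using v disj_verts H1 H2
    by (subst card_insert_disjoint, force simp: hypergraph_def, force)
       (subst card_Un_disjoint, auto simp: hypergraph_def)
  moreover have "card (verts H1) = Suc (card (verts H1 - {v1}))"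
    "card (verts H2) = Suc (card (verts H2 - {v2}))"
    using v H1 H2 by (metis card_Suc_Diff1 hypergraph_def)+
  ultimately show "card (verts (vertex_join H1 v1 H2 v2 v)) + 1 =
      card (verts H1) + card (verts H2)" by simp
qed (use kappa_sub_vertex_join[OF v] disj_edges in
      \<open>auto simp: vertex_join_def hg_union_def Let_def\<close>)

end

theorem proposition2p5:
  fixes H1 H2 :: "('v, 'e) hgraph"
  assumes "hypergraph H1" and "hypergraph H2"
    and "verts H1 \<inter> verts H2 = {}" and "edges H1 \<inter> edges H2 = {}"
  shows "tutte_HG (hg_union H1 H2) = tutte_HG H1 * tutte_HG H2 \<and>
    (\<forall>v1\<in>verts H1. \<forall>v2\<in>verts H2. \<forall>v. v \<notin> (verts H1 \<union> verts H2) - {v1, v2} \<longrightarrow>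
       tutte_HG (vertex_join H1 v1 H2 v2 v) = tutte_HG H1 * tutte_HG H2)"
proof -
  interpret disjoint_hypergraphs H1 H2 using assms by unfold_locales
  show ?thesis using tutte_HG_union tutte_HG_vertex_join by blast
qed

end
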